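(* Let $\approx$ be an SCER on $\Sigma^*$ with prefix encoding $f$, let $\mathcal{D}=\{P_1,\dots,P_d\}$ be a dictionary, and let $T\in\Sigma^*$ be a text of length $n$. Given $\mathrm{SCERA}(\mathcal{D})$ and $T$, Algorithm 1 (described in the context) outputs all $\approx$-occurrence positions of all patterns of $\mathcal{D}$ in $T$ correctly, in $O(E(n) + n\cdot(R(\ell)+\log\pi) + \mathrm{occ})$ time, where $\ell$ is the length of the longest pattern in $\mathcal{D}$, $E(n)$ is the time required to encode $T$, $R(\ell)$ is the time required to re-encode a symbol of a substring of $T$ of length at most $\ell$, $\pi$ is the maximum number of outgoing transitions from any state, and $\mathrm{occ}$ is the number of occurrences of the patterns in $T$.
   Context: Model: word RAM; $\Sigma,\Pi$ are integer alphabets, symbols have constant size and two symbols can be compared in constant time. Strings are 1-indexed; $X[i:j]$ is the substring from $i$ to $j$ ($=\varepsilon$ if $j<i$), $X[:j]=X[1:j]$. An equivalence relation $\approx\subseteq\Sigma^*\times\Sigma^*$ is a substring consistent equivalence relation (SCER) if $X\approx Y$ implies $|X|=|Y|$ and $X[i:j]\approx Y[i:j]$ for all $1\le i\le j\le|X|$. A prefix encoding w.r.t. $\approx$ is a map $f:\Sigma^*\to\Pi^*$ with $|f(X)|=|X|$, $f(X[:i])=f(X)[:i]$, and $f(X)=f(Y)$ iff $X\approx Y$. A position $o$ with $1\le o\le |T|-|P|+1$ is an $\approx$-occurrence of $P$ in $T$ iff $P\approx T[o:o+|P|-1]$; $\mathrm{occ}$ counts pairs (pattern, occurrence). For a string $X$,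 $f(X)$ is computable in $E(|X|)$ time; once $f(X)$ is computed, the last symbol $f(X[i:j])[j-i+1]$ can be computed in $R(|X[i:j]|)$ time. Dictionary $\mathcal{D}=\{P_1,\dots,P_d\}$ of nonempty strings over $\Sigma$, $m=\sum_k|P_k|$, $\ell=\max_k|P_k|$. $\mathrm{Pref}(f(\mathcal{D}))$ is the set of all prefixes of the strings $f(P_1),\dots,f(P_d)$. $\mathrm{SCERA}(\mathcal{D})$: its states are the elements of $\mathrm{Pref}(f(\mathcal{D}))$ (root $=\varepsilon$; depth of a state $S$ is $|S|$). Goto: $\mathrm{goto}(S,c)=Sc$ if $Sc$ is a state, else $\mathrm{Null}$ (then $S$ is the parent of $Sc$); goto is stored as an associative (sorted) array per state, so a lookup costs $O(\log\pi)$ by binary search, where $\pi$ is the maximum number of children of a state. Failure: $\mathrm{Fail}(\varepsilon)=\mathrm{Null}$ and for $1\le j\le|P_k|$, $\mathrm{Fail}(f(P_k)[:j])=f(P_k[i:j])$ with $i=\min\{l\mid l>1,\ f(P_k[l:j])\in\mathrm{Pref}(f(\mathcal{D}))\}$. Output: $\mathrm{Out}(f(P_k)[:j])=\{P\in\mathcal{D}\mid P\approx P_k[i:j]\text{ for some }1\le i\le j\}$. Algorithm 1: add an auxiliary state $\bot$ with $\mathrm{goto}(\bot,c)=$ root for every $c$, $\mathrm{Fail}(\text{root})=\bot$, depth$(\bot)=0$. Compute $f(T)$; set $v\leftarrow$ root; for $i=1,\dots,n$: while $\mathrm{goto}(v, f(T[i-\mathrm{depth}(v):i])[\mathrm{depth}(v)+1])=\mathrm{Null}$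 set $v\leftarrow\mathrm{Fail}(v)$; then set $v\leftarrow \mathrm{goto}(v, f(T[i-\mathrm{depth}(v):i])[\mathrm{depth}(v)+1])$; for each pattern index $j$ with $P_j\in\mathrm{Out}(v)$ output $(j, i-|P_j|+1)$.
   Formalization: Algorithm 1 read literally re-encodes a substring of length ℓ+1 at deepest states, so the bound with R(ℓ) can fail; the time bound is proved if symbols are not re-encoded at leaves or ⊥, or for the literal order if R(ℓ+1) ≤ K·R(ℓ), the constant depending only on K. *)

theory Defs
  imports Complex_Main "HOL-Library.Sublist" "HOL-Library.While_Combinator"
begin

text \<open>The substring from position i to position j, with positions counted from 1;
  it is empty if j < i.\<close>

definition substr :: "'a list \<Rightarrow> nat \<Rightarrow> nat \<Rightarrow> 'a list" where
  "substr X i j = drop (i - 1) (take j X)"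

definition scer :: "('a list \<Rightarrow> 'a list \<Rightarrow> bool) \<Rightarrow> bool" where
  "scer eqv \<longleftrightarrow> equivp eqv \<and>
     (\<forall>X Y. eqv X Y \<longrightarrow> length X = length Y \<and>
        (\<forall>i j. 1 \<le> i \<and> i \<le> j \<and> j \<le> length X \<longrightarrow> eqv (substr X i j) (substr Y i j)))"

definition prefix_encoding ::
  "('a list \<Rightarrow> 'a list \<Rightarrow> bool) \<Rightarrow> ('a list \<Rightarrow> 'b list) \<Rightarrow> bool" where
  "prefix_encoding eqv f \<longleftrightarrow>
     (\<forall>X. length (f X) = length X) \<and>
     (\<forall>X. \<forall>i \<le> length X. f (take i X) = take i (f X)) \<and>
     (\<forall>X Y. f X = f Y \<longleftrightarrow> eqv X Y)"

text \<open>A dictionary is a nonempty list of nonempty patterns. A pattern index is a list index,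
  so it starts at 0; positions in strings start at 1.\<close>

definition dictionary :: "'a list list \<Rightarrow> bool" where
  "dictionary D \<longleftrightarrow> D \<noteq> [] \<and> [] \<notin> set D"

definition max_pattern_length :: "'a list list \<Rightarrow> nat" where
  "max_pattern_length D = Max (length ` set D)"

definition occurrence_at :: "('a list \<Rightarrow> 'a list \<Rightarrow> bool) \<Rightarrow> 'a list \<Rightarrow> 'a list \<Rightarrow> nat \<Rightarrow> bool" where
  "occurrence_at eqv P T pos \<longleftrightarrow>
     1 \<le> pos \<and> int pos \<le> int (length T) - int (length P) + 1 \<and>
     eqv P (substr T pos (pos + length P - 1))"

definition occurrences ::
  "('a list \<Rightarrow> 'a list \<Rightarrow> bool) \<Rightarrow> 'a list list \<Rightarrow> 'a list \<Rightarrow> (nat \<times> nat) set" where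
  "occurrences eqv D T = {(k, pos). k < length D \<and> occurrence_at eqv (D ! k) T pos}"

definition Pref :: "('a list \<Rightarrow> 'b list) \<Rightarrow> 'a list list \<Rightarrow> 'b list set" where
  "Pref f D = {S. \<exists>P \<in> set D. prefix S (f P)}"

definition scera_goto ::
  "('a list \<Rightarrow> 'b list) \<Rightarrow> 'a list list \<Rightarrow> 'b list \<Rightarrow> 'b \<Rightarrow> 'b list option" where
  "scera_goto f D S c = (if S @ [c] \<in> Pref f D then Some (S @ [c]) else None)"

definition symbols_out :: "('a list \<Rightarrow> 'b list) \<Rightarrow> 'a list list \<Rightarrow> 'b list \<Rightarrow> 'b set" where
  "symbols_out f D S = {c. scera_goto f D S c \<noteq> None}"

definition max_children :: "('a list \<Rightarrow> 'b list) \<Rightarrow> 'a list list \<Rightarrow> nat" where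
  "max_children f D = Max ((\<lambda>S. card (symbols_out f D S)) ` Pref f D)"

text \<open>The same state may be a prefix of several encoded patterns. For a prefix encoding of a
  substring consistent equivalence relation the failure state and the output set do not depend
  on the pattern that is used to name the state; see the lemmas scera_fail_eq and
  scera_out_eq below.\<close>

definition fail_start :: "('a list \<Rightarrow> 'b list) \<Rightarrow> 'a list list \<Rightarrow> 'a list \<Rightarrow> nat \<Rightarrow> nat" where
  "fail_start f D P j = (LEAST l. 1 < l \<and> f (substr P l j) \<in> Pref f D)"

definition scera_fail ::
  "('a list \<Rightarrow> 'b list) \<Rightarrow> 'a list list \<Rightarrow> 'b list \<Rightarrow> 'b list option" where
  "scera_fail f D S =
     (if S = [] then None
      else Some (THE S'. \<exists>P \<in> set D. \<exists>j. 1 \<le> j \<and> j \<le> length P \<and> S = take j (f P) \<and>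
                    S' = f (substr P (fail_start f D P j) j)))"

definition scera_out ::
  "('a list \<Rightarrow> 'a list \<Rightarrow> bool) \<Rightarrow> ('a list \<Rightarrow> 'b list) \<Rightarrow> 'a list list \<Rightarrow> 'b list \<Rightarrow> 'a list set" where
  "scera_out eqv f D S =
     {P \<in> set D. \<exists>Q \<in> set D. \<exists>j. 1 \<le> j \<and> j \<le> length Q \<and> S = take j (f Q) \<and>
        (\<exists>i. 1 \<le> i \<and> i \<le> j \<and> eqv P (substr Q i j))}"

text \<open>The data stored at a state: the array of its transitions, sorted by symbol, and the list
  of the indices of the patterns in its output set.\<close>

definition goto_array ::
  "('a list \<Rightarrow> 'b::linorder list) \<Rightarrow> 'a list list \<Rightarrow> 'b list \<Rightarrow> ('b \<times> 'b list) list" where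
  "goto_array f D S =
     map (\<lambda>c. (c, the (scera_goto f D S c))) (sorted_list_of_set (symbols_out f D S))"

definition out_indices ::
  "('a list \<Rightarrow> 'a list \<Rightarrow> bool) \<Rightarrow> ('a list \<Rightarrow> 'b list) \<Rightarrow> 'a list list \<Rightarrow> 'b list \<Rightarrow> nat list" where
  "out_indices eqv f D S = filter (\<lambda>k. D ! k \<in> scera_out eqv f D S) [0..<length D]"

text \<open>Binary search among the entries with indices lo, ..., hi - 1. The second component of the
  result is the running time: one unit for every inspection of the array and one for an empty
  range.\<close>

function bsearch :: "('b::linorder \<times> 's) list \<Rightarrow> 'b \<Rightarrow> nat \<Rightarrow> nat \<Rightarrow> 's option \<times> nat" where
  "bsearch xs c lo hi =
     (if hi \<le> lo then (None, 1)
      else let m = (lo + hi) div 2; b = fst (xs ! m) in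
        if c = b then (Some (snd (xs ! m)), 1)
        else let (r, t) = (if c < b then bsearch xs c lo m else bsearch xs c (Suc m) hi)
             in (r, t + 1))"
  by pat_completeness auto
termination
  by (relation "measure (\<lambda>(_, _, lo, hi). hi - lo)") auto

declare bsearch.simps [simp del]

datatype 'b state = Bot | State "'b list"

fun depth :: "'b state \<Rightarrow> nat" where
  "depth Bot = 0"
| "depth (State S) = length S"

text \<open>The failure function after Bot has been added below the root. The value at Bot is
  irrelevant, since no transition from Bot fails.\<close>

fun aug_fail :: "('a list \<Rightarrow> 'b list) \<Rightarrow> 'a list list \<Rightarrow> 'b state \<Rightarrow> 'b state" where
  "aug_fail f D Bot = Bot"
| "aug_fail f D (State S) = (case scera_fail f D S of None \<Rightarrow> Bot | Some S' \<Rightarrow> State S')"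

text \<open>The symbol of the encoding of T[i - depth v : i] at position depth v + 1.\<close>

definition key :: "('a list \<Rightarrow> 'b list) \<Rightarrow> 'a list \<Rightarrow> 'b state \<Rightarrow> nat \<Rightarrow> 'b" where
  "key f T v i = f (substr T (i - depth v) i) ! depth v"

text \<open>Evaluation of goto (v, key) at text position i: result (None stands for Null) and running
  time. Here re_time X i j is the time for computing the last symbol of the encoding of X[i : j].
  If eager holds, the key is computed before every lookup. Otherwise it is computed only if the
  lookup has to compare it with some entry, i.e. not at Bot and not at a state without outgoing
  transitions. The difference matters at states of maximal depth: there an eager evaluation
  re-encodes a substring that is longer by one than the longest pattern, so that its time is not
  bounded by a bound R l for substrings of at most the maximal pattern length l, unless
  R (l + 1) is bounded by a multiple of R l.\<close>

fun eval_goto ::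
  "('a list \<Rightarrow> 'b::linorder list) \<Rightarrow> ('a list \<Rightarrow> nat \<Rightarrow> nat \<Rightarrow> nat) \<Rightarrow> bool \<Rightarrow>
   'a list list \<Rightarrow> 'a list \<Rightarrow> nat \<Rightarrow> 'b state \<Rightarrow> 'b state option \<times> nat" where
  "eval_goto f re_time eager D T i Bot =
     (Some (State []), (if eager then re_time T i i else 0) + 1)"
| "eval_goto f re_time eager D T i (State S) =
     (let xs = goto_array f D S;
          t0 = (if eager \<or> xs \<noteq> [] then re_time T (i - length S) i else 0);
          (r, t) = bsearch xs (key f T (State S) i) 0 (length xs)
      in (map_option State r, t0 + t))"

text \<open>The while loop at text position i, started at state v. It adds to a clock the time of each
  evaluated loop condition (the last one, which ends the loop, is added in search_step) and one
  unit for each failure transition. The result is None if the loop does not terminate.\<close>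

definition fail_loop ::
  "('a list \<Rightarrow> 'b::linorder list) \<Rightarrow> ('a list \<Rightarrow> nat \<Rightarrow> nat \<Rightarrow> nat) \<Rightarrow> bool \<Rightarrow>
   'a list list \<Rightarrow> 'a list \<Rightarrow> nat \<Rightarrow> 'b state \<times> nat \<Rightarrow> ('b state \<times> nat) option" where
  "fail_loop f re_time eager D T i =
     while_option
       (\<lambda>(v, t). fst (eval_goto f re_time eager D T i v) = None)
       (\<lambda>(v, t). (aug_fail f D v, t + snd (eval_goto f re_time eager D T i v) + 1))"

text \<open>One iteration of the for loop, on the current state, the output so far and the clock.
  After the while loop, goto is evaluated again for the assignment to v, so its time counts
  twice. Each output takes one unit of time, and so does the iteration itself.\<close>

definition search_step ::
  "('a list \<Rightarrow> 'a list \<Rightarrow> bool) \<Rightarrow> ('a list \<Rightarrow> 'b::linorder list) \<Rightarrow>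
   ('a list \<Rightarrow> nat \<Rightarrow> nat \<Rightarrow> nat) \<Rightarrow> bool \<Rightarrow> 'a list list \<Rightarrow> 'a list \<Rightarrow> nat \<Rightarrow>
   'b state \<times> (nat \<times> nat) list \<times> nat \<Rightarrow> ('b state \<times> (nat \<times> nat) list \<times> nat) option" where
  "search_step eqv f re_time eager D T i = (\<lambda>(v, outs, t).
     case fail_loop f re_time eager D T i (v, t) of
       None \<Rightarrow> None
     | Some (v', t') \<Rightarrow>
         (case eval_goto f re_time eager D T i v' of
            (Some (State S), tg) \<Rightarrow>
              let new = map (\<lambda>k. (k, i - length (D ! k) + 1)) (out_indices eqv f D S)
              in Some (State S, outs @ new, t' + 2 * tg + length new + 1)
          | _ \<Rightarrow> None))"

text \<open>The algorithm on a given automaton and text T. The result is the output list and the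
  running time, where enc_time T is the time for encoding T, and one unit is spent on the
  initialisation.\<close>

definition search ::
  "('a list \<Rightarrow> 'a list \<Rightarrow> bool) \<Rightarrow> ('a list \<Rightarrow> 'b::linorder list) \<Rightarrow>
   ('a list \<Rightarrow> nat) \<Rightarrow> ('a list \<Rightarrow> nat \<Rightarrow> nat \<Rightarrow> nat) \<Rightarrow> bool \<Rightarrow>
   'a list list \<Rightarrow> 'a list \<Rightarrow> ((nat \<times> nat) list \<times> nat) option" where
  "search eqv f enc_time re_time eager D T =
     map_option snd
       (fold (\<lambda>i s. Option.bind s (search_step eqv f re_time eager D T i))
             [1..<length T + 1]
             (Some (State [], [], enc_time T + 1)))"

text \<open>Every computation takes at least one unit of time. E n bounds the time for encoding a
  string of length n, and R k the time for re-encoding the last symbol of a substring of length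
  at most k.\<close>

definition time_bounds ::
  "('a list \<Rightarrow> nat) \<Rightarrow> ('a list \<Rightarrow> nat \<Rightarrow> nat \<Rightarrow> nat) \<Rightarrow> (nat \<Rightarrow> real) \<Rightarrow> (nat \<Rightarrow> real) \<Rightarrow> bool" where
  "time_bounds enc_time re_time E R \<longleftrightarrow>
     (\<forall>X. 1 \<le> enc_time X \<and> real (enc_time X) \<le> E (length X)) \<and>
     (\<forall>X i j. 1 \<le> i \<and> i \<le> j \<and> j \<le> length X \<longrightarrow>
        1 \<le> re_time X i j \<and> (\<forall>k \<ge> j - i + 1. real (re_time X i j) \<le> R k))"

lemma length_substr: "length (substr X i j) = min (length X) j - (i - 1)"
  by (simp add: substr_def)

lemma same_state:
  assumes "scer eqv" "prefix_encoding eqv f"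
    and "take j (f P) = take j' (f Q)" "j \<le> length P" "j' \<le> length Q"
  shows "j' = j" and "1 \<le> l \<Longrightarrow> eqv (substr P l j) (substr Q l j)"
proof -
  have len: "length (f X) = length X" for X
    using assms(2) by (simp add: prefix_encoding_def)
  have "length (take j (f P)) = length (take j' (f Q))" using assms(3) by simp
  then show j: "j' = j" using assms(4,5) by (simp add: len)
  assume l: "1 \<le> l"
  have "f (take j P) = f (take j Q)"
    using assms j by (simp add: prefix_encoding_def)
  then have e: "eqv (take j P) (take j Q)"
    using assms(2) by (simp add: prefix_encoding_def)
  show "eqv (substr P l j) (substr Q l j)"
  proof (cases "l \<le> j")
    case True
    have "eqv (substr (take j P) l j) (substr (take j Q) l j)"
      using assms(1,4) e l True by (simp add: scer_def)
    then show ?thesis by (simp add: substr_def)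
  next
    case False
    then have "substr P l j = []" "substr Q l j = []"
      by (simp_all add: substr_def)
    then show ?thesis
      using assms(1) by (simp add: scer_def equivp_reflp)
  qed
qed

lemma scera_fail_eq:
  assumes "scer eqv" "prefix_encoding eqv f" "P \<in> set D" "1 \<le> j" "j \<le> length P"
  shows "scera_fail f D (take j (f P)) = Some (f (substr P (fail_start f D P j) j))"
proof -
  have ne: "take j (f P) \<noteq> []"
    using assms by (auto simp: prefix_encoding_def simp flip: length_0_conv)
  have main: "f (substr Q (fail_start f D Q j') j') = f (substr P (fail_start f D P j) j)"
    if Q: "take j (f P) = take j' (f Q)" "j' \<le> length Q" for Q j'
  proof -
    have j: "j' = j" using same_state(1)[OF assms(1,2) Q(1) assms(5) Q(2)] .
    have eq: "f (substr P l j) = f (substr Q l j)" if "1 \<le> l" for l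
      using same_state(2)[OF assms(1,2) Q(1) assms(5) Q(2) that] assms(2)
      by (simp add: prefix_encoding_def)
    have fs: "fail_start f D Q j = fail_start f D P j"
      unfolding fail_start_def by (rule arg_cong[where f = Least]) (auto simp: eq)
    have f0: "f [] = []"
      using assms(2) by (metis length_0_conv prefix_encoding_def)
    have "1 < Suc j \<and> f (substr P (Suc j) j) \<in> Pref f D"
      using assms f0 by (auto simp: substr_def Pref_def)
    then have "1 < fail_start f D P j"
      unfolding fail_start_def by (rule LeastI2) simp
    then show ?thesis by (simp add: j fs eq)
  qed
  have "(THE S'. \<exists>Q \<in> set D. \<exists>j'. 1 \<le> j' \<and> j' \<le> length Q \<and> take j (f P) = take j' (f Q) \<and>
           S' = f (substr Q (fail_start f D Q j') j')) = f (substr P (fail_start f D P j) j)"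
    by (rule the_equality) (use assms(3-5) main in blast)+
  then show ?thesis
    unfolding scera_fail_def using ne by simp
qed

lemma scera_out_eq:
  assumes "scer eqv" "prefix_encoding eqv f" "Q \<in> set D" "1 \<le> j" "j \<le> length Q"
  shows "scera_out eqv f D (take j (f Q)) =
    {P \<in> set D. \<exists>i. 1 \<le> i \<and> i \<le> j \<and> eqv P (substr Q i j)}"
proof -
  have tr: "eqv X Z" if "eqv X Y" "eqv Y Z" for X Y Z
    using assms(1) that by (meson equivp_transp scer_def)
  have "\<exists>i. 1 \<le> i \<and> i \<le> j \<and> eqv P (substr Q i j)"
    if "take j (f Q) = take j' (f Q')" "j' \<le> length Q'"
       "1 \<le> i" "i \<le> j'" "eqv P (substr Q' i j')" for P Q' j' i
  proof (intro exI conjI)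
    have j: "j' = j" and e: "eqv (substr Q i j) (substr Q' i j)"
      using same_state[OF assms(1,2) that(1) assms(5) that(2)] that(3) by simp_all
    have "eqv (substr Q' i j) (substr Q i j)"
      using assms(1) e by (meson equivp_symp scer_def)
    then show "eqv P (substr Q i j)" using tr that(5) j by blast
    show "1 \<le> i" "i \<le> j" using that(3,4) j by simp_all
  qed
  then show ?thesis
    unfolding scera_out_def
    by (intro Collect_cong) (use assms(3-5) in blast)
qed

end

theory Submission
  imports Defs
begin

text \<open>Call a start position \<open>p\<close> live at \<open>i\<close> if \<open>f (T[p:i])\<close> is a state. After reading \<open>T[i]\<close> the
  algorithm is in the state \<open>f (T[p:i])\<close> for the least live \<open>p\<close>. By substring consistency, a failure
  transition from \<open>f (T[p:i])\<close> moves to the next live position, so the while loop stops at the least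
  position that is live at \<open>i + 1\<close> (the auxiliary state stands for the position \<open>i + 2\<close> there). Every
  occurrence that ends at \<open>i\<close> starts at a live position, hence lies in \<open>T[p:i]\<close> and is found in the
  output set. Each failure transition increases \<open>p\<close>, and \<open>p \<le> n + 1\<close>, so there are at most \<open>n\<close>
  of them in total.\<close>

section \<open>Substrings and binary search\<close>

lemma substr_substr:
  assumes "1 \<le> p" "1 \<le> a" "p + b \<le> Suc i"
  shows "substr (substr X p i) a b = substr X (p + a - 1) (p + b - 1)"
  using assms by (simp add: substr_def take_drop min_def add.commute)

text \<open>The keys increase strictly, so an entry with key \<open>c\<close> is unique and a
  comparison with the middle entry excludes one half of the range.\<close>

lemma fst_bsearch_eq_Some_iff:
  assumes "sorted_wrt (<) (map fst xs)" "hi \<le> length xs"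
  shows "fst (bsearch xs c lo hi) = Some s \<longleftrightarrow> (\<exists>m. lo \<le> m \<and> m < hi \<and> xs ! m = (c, s))"
  using assms(2)
proof (induction "hi - lo" arbitrary: lo hi rule: less_induct)
  case less
  show ?case
  proof (cases "hi \<le> lo")
    case True
    then show ?thesis by (auto simp: bsearch.simps)
  next
    case False
    define m where "m = (lo + hi) div 2"
    have m: "lo \<le> m" "m < hi" using False by (auto simp: m_def)
    have mono: "fst (xs ! a) < fst (xs ! b)" if "a < b" "b < hi" for a b
      using sorted_wrt_nth_less[OF assms(1), of a b] that less.prems by simp
    consider "c = fst (xs ! m)" | "c < fst (xs ! m)" | "fst (xs ! m) < c"
      by force
    then show ?thesis
    proof cases
      case 1
      have "k = m" if "k < hi" "xs ! k = (c, s)" for k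
        using mono[of k m] mono[of m k] that m 1 by (cases k m rule: linorder_cases) auto
      then show ?thesis
        using 1 False m by (subst bsearch.simps) (auto simp: Let_def m_def[symmetric] prod_eq_iff)
    next
      case 2
      have "k < m" if "k < hi" "xs ! k = (c, s)" for k
        using mono[of m k] that 2 by (cases k m rule: linorder_cases) auto
      then have "(\<exists>k. lo \<le> k \<and> k < hi \<and> xs ! k = (c, s)) \<longleftrightarrow>
          (\<exists>k. lo \<le> k \<and> k < m \<and> xs ! k = (c, s))"
        using m by (meson less_trans)
      moreover have "fst (bsearch xs c lo hi) = fst (bsearch xs c lo m)"
        using 2 False by (subst bsearch.simps) (auto simp: Let_def m_def[symmetric] split: prod.split)
      moreover have "fst (bsearch xs c lo m) = Some s \<longleftrightarrow> (\<exists>k. lo \<le> k \<and> k < m \<and> xs ! k = (c, s))"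
        by (rule less.hyps) (use m less.prems in auto)
      ultimately show ?thesis by simp
    next
      case 3
      have "Suc m \<le> k" if "k < hi" "xs ! k = (c, s)" for k
        using mono[of k m] that 3 m by (cases k m rule: linorder_cases) auto
      then have "(\<exists>k. lo \<le> k \<and> k < hi \<and> xs ! k = (c, s)) \<longleftrightarrow>
          (\<exists>k. Suc m \<le> k \<and> k < hi \<and> xs ! k = (c, s))"
        using m by (meson Suc_leD le_trans)
      moreover have "fst (bsearch xs c lo hi) = fst (bsearch xs c (Suc m) hi)"
        using 3 False by (subst bsearch.simps) (auto simp: Let_def m_def[symmetric] split: prod.split)
      moreover have "fst (bsearch xs c (Suc m) hi) = Some s \<longleftrightarrow>
          (\<exists>k. Suc m \<le> k \<and> k < hi \<and> xs ! k = (c, s))"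
        by (rule less.hyps) (use m less.prems in auto)
      ultimately show ?thesis by simp
    qed
  qed
qed

lemma log2_of_nat_nonneg: "0 \<le> log 2 (real n)"
  by (cases "n = 0") (auto simp: log_def)

lemma log2_of_nat_mono:
  assumes "m \<le> n" shows "log 2 (real m) \<le> log 2 (real n)"
proof (cases "m = 0")
  case True
  then show ?thesis using log2_of_nat_nonneg[of n] by (simp add: log_def)
next
  case False
  then show ?thesis using assms by simp
qed

text \<open>Each failed comparison at least halves the range. A failed search in a range of length 1
  attains the constant: one inspection and one unit for the empty range, with
  \<open>log 2 1 = 0\<close>. Empty ranges are covered because \<open>log 2 0 = 0\<close>.\<close>

lemma snd_bsearch_le: "real (snd (bsearch xs c lo hi)) \<le> log 2 (real (hi - lo)) + 2"
proof (induction "hi - lo" arbitrary: lo hi rule: less_induct)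
  case less
  show ?case
  proof (cases "hi \<le> lo")
    case True
    then show ?thesis by (simp add: bsearch.simps log_def)
  next
    case False
    define m where "m = (lo + hi) div 2"
    have m: "lo \<le> m" "m < hi" using False by (auto simp: m_def)
    \<comment> \<open>Serves both recursive calls: halving the range lowers the logarithm by at
      least 1, which pays for the comparison. This works only for positive lengths, so an empty
      subrange is treated separately.\<close>
    have rec: "real (snd (bsearch xs c lo' hi')) + 1 \<le> log 2 (real (hi - lo)) + 2"
      if "2 * (hi' - lo') \<le> hi - lo" for lo' hi'
    proof (cases "hi' \<le> lo'")
      case True
      then show ?thesis using log2_of_nat_nonneg[of "hi - lo"] by (simp add: bsearch.simps)
    next
      case F: False
      have "real (snd (bsearch xs c lo' hi')) \<le> log 2 (real (hi' - lo')) + 2"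
        by (rule less.hyps) (use that False in auto)
      moreover have "log 2 (real (hi' - lo')) + 1 = log 2 (2 * real (hi' - lo'))"
        using F log_mult[of 2 "real (hi' - lo')" 2] by (simp add: mult.commute del: of_nat_diff)
      moreover have "log 2 (2 * real (hi' - lo')) \<le> log 2 (real (hi - lo))"
        using F that by (subst log_le_cancel_iff) linarith+
      ultimately show ?thesis by linarith
    qed
    have "2 * (m - lo) \<le> hi - lo" "2 * (hi - Suc m) \<le> hi - lo"
      using False by (auto simp: m_def)
    note r = rec[OF this(1)] rec[OF this(2)]
    show ?thesis
      using r False log2_of_nat_nonneg[of "hi - lo"]
      by (subst bsearch.simps) (auto simp: Let_def m_def[symmetric] split: prod.split)
  qed
qed

section \<open>Finiteness of the automaton and its transition arrays\<close>

lemma finite_Pref: "finite (Pref f D)"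
proof -
  have "Pref f D = (\<Union>P\<in>set D. set (prefixes (f P)))"
    by (auto simp: Pref_def)
  then show ?thesis by simp
qed

text \<open>The symbols form an injective preimage of the finite set of states. Finiteness matters
  because \<open>sorted_list_of_set\<close> returns \<open>[]\<close> on infinite sets.\<close>

lemma finite_symbols_out: "finite (symbols_out f D S)"
proof -
  have "symbols_out f D S = (\<lambda>c. S @ [c]) -` Pref f D"
    by (auto simp: symbols_out_def scera_goto_def)
  then show ?thesis
    by (simp add: finite_Pref finite_vimageI inj_def)
qed

lemma Pref_prefix: "S \<in> Pref f D \<Longrightarrow> prefix S' S \<Longrightarrow> S' \<in> Pref f D"
  unfolding Pref_def using prefix_order.trans by blast

lemma length_goto_array_le:
  assumes "S \<in> Pref f D"
  shows "length (goto_array f D S) \<le> max_children f D"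
  using assms by (auto simp: goto_array_def max_children_def finite_Pref intro!: Max_ge)

text \<open>Links the stored array to the transition function; from here on only
  \<open>scera_goto\<close> enters the correctness argument.\<close>

lemma bsearch_goto_array:
  "fst (bsearch (goto_array f D S) c 0 (length (goto_array f D S))) = scera_goto f D S c"
proof -
  let ?xs = "goto_array f D S" and ?cs = "sorted_list_of_set (symbols_out f D S)"
  have "map fst ?xs = ?cs"
    by (simp add: goto_array_def comp_def)
  then have "sorted_wrt (<) (map fst ?xs)"
    by simp
  then have "fst (bsearch ?xs c 0 (length ?xs)) = Some s \<longleftrightarrow> (c, s) \<in> set ?xs" for s
    by (subst fst_bsearch_eq_Some_iff) (auto simp: in_set_conv_nth)
  moreover have "(c, s) \<in> set ?xs \<longleftrightarrow> scera_goto f D S c = Some s" for s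
  proof -
    have "set ?cs = symbols_out f D S"
      by (simp add: finite_symbols_out)
    then show ?thesis
      by (auto simp: goto_array_def symbols_out_def)
  qed
  ultimately show ?thesis
    by (metis option.exhaust)
qed

lemma fst_eval_goto_State:
  "fst (eval_goto f re_time eager D T i (State S)) =
     map_option State (scera_goto f D S (key f T (State S) i))"
  by (simp add: Let_def bsearch_goto_array[symmetric] split: prod.split)

section \<open>Setting and basic facts on encodings\<close>

locale scera_search =
  fixes eqv :: "'a list \<Rightarrow> 'a list \<Rightarrow> bool" and f :: "'a list \<Rightarrow> 'b::linorder list"
    and enc_time :: "'a list \<Rightarrow> nat" and re_time :: "'a list \<Rightarrow> nat \<Rightarrow> nat \<Rightarrow> nat"
    and E R :: "nat \<Rightarrow> real" and D :: "'a list list" and T :: "'a list" and eager :: bool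
  assumes scer: "scer eqv" and encoding: "prefix_encoding eqv f"
    and time_bounds: "time_bounds enc_time re_time E R" and dictionary: "dictionary D"
begin

abbreviation "maxlen \<equiv> max_pattern_length D"

abbreviation "eval i v \<equiv> eval_goto f re_time eager D T i v"

lemma length_f [simp]: "length (f X) = length X"
  using encoding by (simp add: prefix_encoding_def)

lemma f_take: "i \<le> length X \<Longrightarrow> f (take i X) = take i (f X)"
  using encoding by (simp add: prefix_encoding_def)

lemma f_eq_iff: "f X = f Y \<longleftrightarrow> eqv X Y"
  using encoding by (simp add: prefix_encoding_def)

lemma f_Nil [simp]: "f [] = []"
  by (metis length_0_conv length_f)

text \<open>Substring consistency read through \<open>f\<close>. For \<open>b < a\<close> both
  substrings are empty; this case occurs for failures to the root.\<close>

lemma f_substr_cong: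
  assumes "f X = f Y" "1 \<le> a" "b \<le> length X"
  shows "f (substr X a b) = f (substr Y a b)"
proof (cases "a \<le> b")
  case True
  then show ?thesis using assms scer by (simp add: f_eq_iff scer_def)
next
  case False
  then show ?thesis by (simp add: substr_def)
qed

lemma f_mem_Pref: "P \<in> set D \<Longrightarrow> f P \<in> Pref f D"
  by (auto simp: Pref_def)

lemma length_pattern_le: "P \<in> set D \<Longrightarrow> length P \<le> maxlen"
  by (simp add: max_pattern_length_def)

lemma length_Pref_le: "S \<in> Pref f D \<Longrightarrow> length S \<le> maxlen"
  unfolding Pref_def using length_pattern_le prefix_length_le by fastforce

lemma Nil_mem_Pref: "[] \<in> Pref f D"
  using dictionary by (auto simp: Pref_def dictionary_def neq_Nil_conv)

lemma one_le_max_pattern_length: "1 \<le> maxlen"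
proof -
  have "hd D \<in> set D" "hd D \<noteq> []"
    using dictionary by (metis dictionary_def hd_in_set)+
  then show ?thesis
    using length_pattern_le[of "hd D"] by (metis One_nat_def Suc_leI length_greater_0_conv le_trans)
qed

lemma re_time_le: "1 \<le> i \<Longrightarrow> i \<le> j \<Longrightarrow> j \<le> length X \<Longrightarrow> j - i + 1 \<le> k \<Longrightarrow> real (re_time X i j) \<le> R k"
  using time_bounds by (simp add: time_bounds_def)

text \<open>Any one-letter string is a witness: re-encoding its letter costs at least 1 and at most
  \<open>R k\<close>. This later absorbs additive constants into \<open>R\<close>.\<close>

lemma one_le_R:
  assumes "1 \<le> k" shows "1 \<le> R k"
proof -
  have "1 \<le> re_time [undefined] 1 1"
    using time_bounds by (simp add: time_bounds_def)
  moreover have "real (re_time [undefined] 1 1) \<le> R k"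
    using assms by (intro re_time_le) auto
  ultimately show ?thesis by linarith
qed

section \<open>Live positions and the failure function\<close>

definition live :: "nat \<Rightarrow> nat \<Rightarrow> bool" where
  "live p i \<longleftrightarrow> 1 \<le> p \<and> p \<le> Suc i \<and> f (substr T p i) \<in> Pref f D"

lemma live_Suc_self: "live (Suc i) i"
  by (simp add: live_def substr_def Nil_mem_Pref)

text \<open>By the prefix property of \<open>f\<close> the key is the only new symbol, so following
  it from the state of \<open>T[p:i]\<close> leads to that of \<open>T[p:i+1]\<close>.\<close>

lemma f_substr_Suc:
  assumes "1 \<le> p" "p \<le> Suc i" "Suc i \<le> length T"
  shows "f (substr T p (Suc i)) = f (substr T p i) @ [key f T (State (f (substr T p i))) (Suc i)]"
proof -
  let ?X = "substr T p (Suc i)" and ?n = "Suc i - p"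
  have len: "length ?X = Suc ?n" "length (substr T p i) = ?n"
    using assms by (simp_all add: length_substr)
  have "take ?n ?X = substr T p i"
    using assms by (simp add: substr_def take_drop min_def)
  then have "take ?n (f ?X) = f (substr T p i)"
    using f_take[of ?n ?X] len by simp
  moreover have "key f T (State (f (substr T p i))) (Suc i) = f ?X ! ?n"
    using assms by (simp add: key_def len)
  moreover have "f ?X = take ?n (f ?X) @ [f ?X ! ?n]"
    using len by (metis length_f lessI order_refl take_Suc_conv_app_nth take_all)
  ultimately show ?thesis by simp
qed

text \<open>\<open>Pref f D\<close> is closed under prefixes, so reading a letter can only kill
  positions; the sole newcomer is \<open>Suc (Suc i)\<close>.\<close>

lemma live_Suc:
  assumes "live p (Suc i)" "p \<le> Suc i" "Suc i \<le> length T"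
  shows "live p i"
  using assms Pref_prefix f_substr_Suc[of p i] by (fastforce simp: live_def)

text \<open>Failure and output are defined through a pattern \<open>Q\<close> that names the state.
  A prefix of \<open>Q\<close> is equivalent to the current substring of \<open>T\<close>, so
  substrings of \<open>Q\<close> can be exchanged for substrings of \<open>T\<close>, shifted by
  \<open>p - 1\<close>.\<close>

lemma live_obtain_pattern:
  assumes "live p i" "i \<le> length T"
  obtains Q where "Q \<in> set D" "f (substr T p i) = take (Suc i - p) (f Q)" "Suc i - p \<le> length Q"
    and "\<And>l. 1 \<le> l \<Longrightarrow> f (substr Q l (Suc i - p)) = f (substr T (p + l - 1) i)"
proof -
  let ?X = "substr T p i" and ?j = "Suc i - p"
  have p: "1 \<le> p" "p \<le> Suc i" using assms by (auto simp: live_def)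
  have len: "length ?X = ?j" using assms p by (simp add: length_substr)
  obtain Q where Q: "Q \<in> set D" "prefix (f ?X) (f Q)"
    using assms by (auto simp: live_def Pref_def)
  have jQ: "?j \<le> length Q" using prefix_length_le[OF Q(2)] len by simp
  have eq: "f ?X = take ?j (f Q)" using Q(2) len by (auto simp: prefix_def)
  have "f (substr Q l ?j) = f (substr T (p + l - 1) i)" if "1 \<le> l" for l
  proof -
    have "f (substr ?X l ?j) = f (substr (take ?j Q) l ?j)"
      by (rule f_substr_cong) (use eq jQ that len in \<open>auto simp: f_take\<close>)
    moreover have "substr (take ?j Q) l ?j = substr Q l ?j"
      by (simp add: substr_def)
    moreover have "substr ?X l ?j = substr T (p + l - 1) i"
      using p that by (simp add: substr_substr)
    ultimately show ?thesis by simp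
  qed
  then show thesis using that Q(1) eq jQ by blast
qed

text \<open>The shift from \<open>l\<close> to \<open>p + l - 1\<close> turns the least
  \<open>l > 1\<close> in \<open>fail_start\<close> into the least live position after
  \<open>p\<close>.\<close>

lemma scera_fail_live:
  assumes "live p i" "p \<le> i" "i \<le> length T"
  obtains p' where "p < p'" "live p' i" "\<And>q. p < q \<Longrightarrow> q < p' \<Longrightarrow> \<not> live q i"
    and "scera_fail f D (f (substr T p i)) = Some (f (substr T p' i))"
proof -
  let ?j = "Suc i - p"
  obtain Q where Q: "Q \<in> set D" "f (substr T p i) = take ?j (f Q)" "?j \<le> length Q"
    and sub: "\<And>l. 1 \<le> l \<Longrightarrow> f (substr Q l ?j) = f (substr T (p + l - 1) i)"
    by (rule live_obtain_pattern[OF assms(1,3)]) (rule that)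
  let ?good = "\<lambda>l. 1 < l \<and> f (substr Q l ?j) \<in> Pref f D"
  define l where "l = fail_start f D Q ?j"
  have p: "1 \<le> p" using assms(1) by (simp add: live_def)
  \<comment> \<open>The empty substring at \<open>l = Suc ?j\<close> is a state, so the minimum in
    \<open>fail_start\<close> exists.\<close>
  have top: "?good (Suc ?j)"
    using assms(2) Nil_mem_Pref by (simp add: substr_def)
  have l: "?good l" "l \<le> Suc ?j"
    unfolding l_def fail_start_def
    using LeastI[of ?good, OF top] Least_le[of ?good, OF top] by blast+
  show thesis
  proof (rule that[of "p + l - 1"])
    show "p < p + l - 1" using l(1) by linarith
    have "1 \<le> p + l - 1" "p + l - 1 \<le> Suc i"
      using l p assms(2) by linarith+
    then show "live (p + l - 1) i"
      using l sub[of l] by (simp add: live_def)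
    show "scera_fail f D (f (substr T p i)) = Some (f (substr T (p + l - 1) i))"
      using scera_fail_eq[OF scer encoding Q(1), of ?j] Q(2,3) assms(2) l sub[of l]
      by (simp add: l_def)
    show "\<not> live q i" if "p < q" "q < p + l - 1" for q
    proof
      assume "live q i"
      then have "?good (Suc q - p)"
        using that sub[of "Suc q - p"] by (simp add: live_def)
      then have "l \<le> Suc q - p"
        unfolding l_def fail_start_def by (rule Least_le)
      then show False using that by simp
    qed
  qed
qed

section \<open>Evaluation of a transition: result and cost\<close>

text \<open>Positions beyond \<open>Suc i\<close> are mapped to \<open>Bot\<close>, so the failure
  from the root also increases the position, while a successful transition keeps \<open>p\<close>
  and only advances \<open>i\<close>.\<close>

definition state_at :: "nat \<Rightarrow> nat \<Rightarrow> 'b state" where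
  "state_at p i = (if p \<le> Suc i then State (f (substr T p i)) else Bot)"

text \<open>For \<open>p \<le> Suc i\<close> the target is given by \<open>f_substr_Suc\<close>.
  \<open>Bot\<close> moves to the root, which is the state of the empty substring starting at
  \<open>Suc (Suc i)\<close>.\<close>

lemma fst_eval_state_at:
  assumes "1 \<le> p" "p \<le> Suc (Suc i)" "Suc i \<le> length T"
  shows "fst (eval (Suc i) (state_at p i)) =
    (if live p (Suc i) then Some (state_at p (Suc i)) else None)"
proof (cases "p \<le> Suc i")
  case True
  then show ?thesis
    using assms f_substr_Suc[of p i]
    by (simp add: state_at_def fst_eval_goto_State scera_goto_def live_def del: eval_goto.simps)
next
  case False
  then have "p = Suc (Suc i)" using assms by simp
  then show ?thesis
    using live_Suc_self[of "Suc i"] by (simp add: state_at_def substr_def)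
qed

text \<open>An eager evaluation at a state of depth \<open>maxlen\<close> re-encodes a substring of length \<open>maxlen + 1\<close>.\<close>

definition eval_bound :: real where
  "eval_bound = R (if eager then maxlen + 1 else maxlen) + log 2 (real (max_children f D)) + 2"

text \<open>The re-encoded substring is longer by 1 than the depth. A state with a nonempty array
  has a child, hence depth below \<open>maxlen\<close>; under eager evaluation the depth is only
  known to be at most \<open>maxlen\<close>.\<close>

lemma snd_eval_state_at:
  assumes "live p i \<or> p = Suc (Suc i)" "Suc i \<le> length T"
  shows "real (snd (eval (Suc i) (state_at p i))) \<le> eval_bound"
proof (cases "p \<le> Suc i")
  case False
  have "real (re_time T (Suc i) (Suc i)) \<le> R (maxlen + 1)"
    using assms by (intro re_time_le) auto
  moreover have "1 \<le> R (if eager then maxlen + 1 else maxlen)"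
    using one_le_max_pattern_length by (intro one_le_R) auto
  ultimately show ?thesis
    using False log2_of_nat_nonneg[of "max_children f D"]
    by (auto simp: state_at_def eval_bound_def)
next
  case True
  let ?S = "f (substr T p i)"
  let ?xs = "goto_array f D ?S"
  let ?r = "if eager \<or> ?xs \<noteq> [] then re_time T (Suc i - length ?S) (Suc i) else 0"
  let ?b = "bsearch ?xs (key f T (State ?S) (Suc i)) 0 (length ?xs)"
  have live: "live p i" using True assms by auto
  then have S: "?S \<in> Pref f D" and p: "1 \<le> p" by (auto simp: live_def)
  have len: "length ?S = Suc i - p" using assms p by (simp add: length_substr)
  have "real (snd ?b) \<le> log 2 (real (length ?xs)) + 2"
    using snd_bsearch_le[of ?xs _ 0 "length ?xs"] by simp
  also have "log 2 (real (length ?xs)) \<le> log 2 (real (max_children f D))"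
    by (rule log2_of_nat_mono[OF length_goto_array_le[OF S]])
  finally have b: "real (snd ?b) \<le> log 2 (real (max_children f D)) + 2" by simp
  have depth_lt: "length ?S < maxlen" if "?xs \<noteq> []"
  proof -
    from that have "symbols_out f D ?S \<noteq> {}"
      by (auto simp: goto_array_def)
    then obtain c where "?S @ [c] \<in> Pref f D"
      by (auto simp: symbols_out_def scera_goto_def split: if_splits)
    then show ?thesis using length_Pref_le by fastforce
  qed
  have r: "real ?r \<le> R (if eager then maxlen + 1 else maxlen)"
  proof (cases "eager \<or> ?xs \<noteq> []")
    case T: True
    have "Suc i - p < (if eager then maxlen + 1 else maxlen)"
      using T length_Pref_le[OF S] depth_lt len by (auto split: if_splits)
    then have "real (re_time T p (Suc i)) \<le> R (if eager then maxlen + 1 else maxlen)"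
      using True p assms by (intro re_time_le) (auto split: if_splits)
    moreover have "?r = re_time T p (Suc i)"
      using T True unfolding len by simp
    ultimately show ?thesis by simp
  next
    case F: False
    have "1 \<le> R (if eager then maxlen + 1 else maxlen)"
      using one_le_max_pattern_length by (intro one_le_R) auto
    then show ?thesis using F by simp
  qed
  have "snd (eval (Suc i) (State ?S)) = ?r + snd ?b"
    by (simp add: Let_def split: prod.split)
  then show ?thesis
    using True b r by (simp add: state_at_def eval_bound_def del: eval_goto.simps)
qed

lemma eval_bound_nonneg: "0 \<le> eval_bound"
  using one_le_R[of maxlen] one_le_R[of "maxlen + 1"] one_le_max_pattern_length
    log2_of_nat_nonneg[of "max_children f D"]
  by (simp add: eval_bound_def)

section \<open>The while loop\<close>

text \<open>Induction on the distance to \<open>Suc (Suc i)\<close>, which is always live at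
  \<open>Suc i\<close> and so bounds the loop. Each round is charged to an increase of the position
  by at least 1.\<close>

lemma fail_loop_state_at:
  assumes "live p i \<or> p = Suc (Suc i)" "Suc i \<le> length T"
    and "\<And>q. q < p \<Longrightarrow> \<not> live q (Suc i)"
  shows "\<exists>q t'. fail_loop f re_time eager D T (Suc i) (state_at p i, t) = Some (state_at q i, t') \<and>
    p \<le> q \<and> live q (Suc i) \<and> (live q i \<or> q = Suc (Suc i)) \<and> (\<forall>q'<q. \<not> live q' (Suc i)) \<and>
    real t' \<le> real t + real (q - p) * (eval_bound + 1)"
  using assms
proof (induction "Suc (Suc i) - p" arbitrary: p t rule: less_induct)
  case less
  have p: "1 \<le> p" "p \<le> Suc (Suc i)" using less.prems(1) by (auto simp: live_def)
  note ev = fst_eval_state_at[OF p less.prems(2)]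
  show ?case
  proof (cases "live p (Suc i)")
    case True
    then have "fail_loop f re_time eager D T (Suc i) (state_at p i, t) = Some (state_at p i, t)"
      unfolding fail_loop_def using ev by (subst while_option_unfold) simp
    then show ?thesis using True less.prems by auto
  next
    case False
    have "p \<noteq> Suc (Suc i)" using False live_Suc_self by auto
    then have live: "live p i" and pi: "p \<le> Suc i" using less.prems(1) p by auto
    obtain p' where p': "p < p'" "live p' i \<or> p' = Suc (Suc i)"
      "\<And>q. p < q \<Longrightarrow> q < p' \<Longrightarrow> \<not> live q i"
      "p' \<le> Suc (Suc i)" "aug_fail f D (state_at p i) = state_at p' i"
    proof (cases "p \<le> i")
      case True
      obtain p' where "p < p'" "live p' i" "\<And>q. p < q \<Longrightarrow> q < p' \<Longrightarrow> \<not> live q i"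
        "scera_fail f D (f (substr T p i)) = Some (f (substr T p' i))"
        using scera_fail_live[OF live True] less.prems(2) by (metis Suc_leD)
      then show thesis
        using that[of p'] pi by (simp add: state_at_def live_def)
    next
      case False
      then have "p = Suc i" using pi by simp
      then show thesis
        using that[of "Suc (Suc i)"] by (simp add: state_at_def substr_def scera_fail_def)
    qed
    let ?t = "t + snd (eval (Suc i) (state_at p i)) + 1"
    have step: "fail_loop f re_time eager D T (Suc i) (state_at p i, t) =
        fail_loop f re_time eager D T (Suc i) (state_at p' i, ?t)"
      unfolding fail_loop_def using ev False p'(5) by (subst while_option_unfold) simp
    \<comment> \<open>The positions skipped by the failure transition are dead at \<open>i\<close>,
      hence also at \<open>Suc i\<close>, so minimality is kept.\<close>
    have dead: "\<not> live q (Suc i)" if "q < p'" for q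
    proof
      assume q: "live q (Suc i)"
      have "p \<le> q" using less.prems(3) q not_le by blast
      moreover have "q \<noteq> p" using q False by blast
      moreover have "live q i"
        using live_Suc[OF q _ less.prems(2)] that p'(4) by linarith
      ultimately show False using p'(3)[of q] that by simp
    qed
    obtain q t' where q: "fail_loop f re_time eager D T (Suc i) (state_at p' i, ?t) = Some (state_at q i, t')"
      "p' \<le> q" "live q (Suc i)" "live q i \<or> q = Suc (Suc i)" "\<forall>q'<q. \<not> live q' (Suc i)"
      "real t' \<le> real ?t + real (q - p') * (eval_bound + 1)"
    proof -
      have "Suc (Suc i) - p' < Suc (Suc i) - p" using p'(1,4) by linarith
      from less.hyps[OF this p'(2) less.prems(2) dead, of ?t] show thesis
        using that by blast
    qed
    have "real ?t \<le> real t + (eval_bound + 1)"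
      using snd_eval_state_at[OF less.prems(1,2)] by simp
    also have "\<dots> + real (q - p') * (eval_bound + 1) = real t + real (q - p' + 1) * (eval_bound + 1)"
      by (simp add: algebra_simps)
    also have "\<dots> \<le> real t + real (q - p) * (eval_bound + 1)"
      using p'(1) q(2) eval_bound_nonneg by (intro add_left_mono mult_right_mono) auto
    finally have "real t' \<le> real t + real (q - p) * (eval_bound + 1)"
      using q(6) by simp
    then show ?thesis
      unfolding step using q p'(1) by (intro exI[of _ q] exI[of _ t']) auto
  qed
qed

section \<open>Occurrences and output sets\<close>

text \<open>The occurrences to be reported once \<open>T[i]\<close> has been read. Different
  \<open>i\<close> give disjoint sets, hence an output without repetitions.\<close>

definition occurrences_ending :: "nat \<Rightarrow> (nat \<times> nat) set" where
  "occurrences_ending i = {(k, pos) \<in> occurrences eqv D T. pos + length (D ! k) = Suc i}"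

lemma length_eq_if_f_eq_substr:
  assumes "f P = f (substr T pos i)" "i \<le> length T"
  shows "length P = i - (pos - 1)"
proof -
  have "length (f P) = length (f (substr T pos i))" using assms(1) by simp
  then show ?thesis using assms(2) by (simp add: length_substr)
qed

lemma occurrences_ending_iff:
  assumes "1 \<le> i" "i \<le> length T"
  shows "(k, pos) \<in> occurrences_ending i \<longleftrightarrow>
    k < length D \<and> 1 \<le> pos \<and> pos \<le> i \<and> pos = i - length (D ! k) + 1 \<and> f (D ! k) = f (substr T pos i)"
proof (cases "k < length D \<and> 1 \<le> pos \<and> f (D ! k) = f (substr T pos i)")
  case True
  \<comment> \<open>Nonemptiness of the pattern rules out \<open>pos > i\<close>, where the
    substring of the text is empty.\<close>
  then have "D ! k \<noteq> []"
    using dictionary by (metis dictionary_def nth_mem)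
  moreover have len: "length (D ! k) = i - (pos - 1)"
    using True assms(2) by (intro length_eq_if_f_eq_substr) auto
  ultimately have "pos \<le> i"
    using True by (cases "pos \<le> i") auto
  then show ?thesis
    using True assms len
    by (auto simp: occurrences_ending_def occurrences_def occurrence_at_def f_eq_iff)
next
  case False
  have "pos + length (D ! k) - 1 = i" if "pos + length (D ! k) = Suc i"
    using that by simp
  then show ?thesis
    using False
    by (auto simp: occurrences_ending_def occurrences_def occurrence_at_def f_eq_iff)
qed

text \<open>Among the occurrences ending at \<open>i\<close>, the output set records exactly those
  that start at \<open>p\<close> or later; by minimality of \<open>p\<close> none starts
  earlier.\<close>

lemma out_indices_live:
  assumes "live p i" "\<And>q. q < p \<Longrightarrow> \<not> live q i" "1 \<le> i" "i \<le> length T"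
  shows "set (map (\<lambda>k. (k, i - length (D ! k) + 1)) (out_indices eqv f D (f (substr T p i)))) =
    occurrences_ending i"
proof -
  let ?S = "f (substr T p i)" and ?j = "Suc i - p"
  have p: "1 \<le> p" "p \<le> Suc i" using assms(1) by (auto simp: live_def)
  have out: "P \<in> scera_out eqv f D ?S \<longleftrightarrow> (\<exists>pos\<ge>p. pos \<le> i \<and> f P = f (substr T pos i))"
    if "P \<in> set D" for P
  proof (cases "p \<le> i")
    case True
    obtain Q where Q: "Q \<in> set D" "?S = take ?j (f Q)" "?j \<le> length Q"
      and sub: "\<And>l. 1 \<le> l \<Longrightarrow> f (substr Q l ?j) = f (substr T (p + l - 1) i)"
      by (rule live_obtain_pattern[OF assms(1,4)]) (rule that)
    have "P \<in> scera_out eqv f D ?S \<longleftrightarrow> (\<exists>l\<ge>1. l \<le> ?j \<and> f P = f (substr Q l ?j))"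
      using scera_out_eq[OF scer encoding Q(1), of ?j] Q True that by (auto simp: f_eq_iff)
    also have "\<dots> \<longleftrightarrow> (\<exists>l\<ge>1. l \<le> ?j \<and> f P = f (substr T (p + l - 1) i))"
      using sub by auto
    also have "\<dots> \<longleftrightarrow> (\<exists>pos\<ge>p. pos \<le> i \<and> f P = f (substr T pos i))"
    proof safe
      fix l assume "1 \<le> l" "l \<le> ?j" "f P = f (substr T (p + l - 1) i)"
      then show "\<exists>pos\<ge>p. pos \<le> i \<and> f P = f (substr T pos i)"
        by (intro exI[of _ "p + l - 1"]) auto
    next
      fix pos assume "p \<le> pos" "pos \<le> i" "f P = f (substr T pos i)"
      then show "\<exists>l\<ge>1. l \<le> ?j \<and> f P = f (substr T (p + l - 1) i)"
        by (intro exI[of _ "Suc pos - p"]) auto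
    qed
    finally show ?thesis .
  next
    case False
    \<comment> \<open>\<open>scera_out\<close> requires \<open>1 \<le> j\<close>, so the root has no
      outputs; likewise no start lies between \<open>p = Suc i\<close> and \<open>i\<close>.\<close>
    then have "?S = []" by (simp add: substr_def)
    then have "P \<notin> scera_out eqv f D ?S"
      by (auto simp: scera_out_def simp flip: length_0_conv)
    then show ?thesis using False by auto
  qed
  have "(k, pos) \<in> set (map (\<lambda>k. (k, i - length (D ! k) + 1)) (out_indices eqv f D ?S)) \<longleftrightarrow>
    (k, pos) \<in> occurrences_ending i" for k pos
  proof -
    have start: "q = i - length (D ! k) + 1"
      if "f (D ! k) = f (substr T q i)" "p \<le> q" "q \<le> i" for q
      using length_eq_if_f_eq_substr[OF that(1) assms(4)] that p by linarith
    \<comment> \<open>A complete encoded pattern is a state, so every occurrence starts at a live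
      position.\<close>
    have ge: "p \<le> q" if "k < length D" "f (D ! k) = f (substr T q i)" "1 \<le> q" "q \<le> i" for q
    proof -
      have "live q i"
        using that f_mem_Pref[of "D ! k"] by (simp add: live_def)
      then show ?thesis using assms(2) by (meson not_le)
    qed
    have "(k, pos) \<in> set (map (\<lambda>k. (k, i - length (D ! k) + 1)) (out_indices eqv f D ?S)) \<longleftrightarrow>
        k < length D \<and> pos = i - length (D ! k) + 1 \<and> (\<exists>q\<ge>p. q \<le> i \<and> f (D ! k) = f (substr T q i))"
      using out[of "D ! k"] by (auto simp: out_indices_def)
    also have "\<dots> \<longleftrightarrow> k < length D \<and> 1 \<le> pos \<and> pos \<le> i \<and> pos = i - length (D ! k) + 1 \<and>
        f (D ! k) = f (substr T pos i)"
      using start ge p(1) by (metis le_trans)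
    finally show ?thesis
      using occurrences_ending_iff[OF assms(3,4)] by simp
  qed
  then show ?thesis by auto
qed

section \<open>The main loop\<close>

definition run :: "nat \<Rightarrow> ('b state \<times> (nat \<times> nat) list \<times> nat) option" where
  "run i = fold (\<lambda>i s. Option.bind s (search_step eqv f re_time eager D T i))
     [1..<i + 1] (Some (State [], [], enc_time T + 1))"

lemma run_0: "run 0 = Some (State [], [], enc_time T + 1)"
  by (simp add: run_def)

lemma run_Suc: "run (Suc i) = Option.bind (run i) (search_step eqv f re_time eager D T (Suc i))"
  by (simp add: run_def)

text \<open>Amortised analysis with potential \<open>p - 1\<close>, which bounds the number of
  failure transitions so far. Each letter adds two evaluations, the last loop test and the
  assignment, and one unit; \<open>E (length T) + 1\<close> covers encoding and
  initialisation.\<close>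

lemma run_invariant:
  assumes "i \<le> length T"
  shows "\<exists>p outs t. run i = Some (state_at p i, outs, t) \<and> live p i \<and> (\<forall>q<p. \<not> live q i) \<and>
    distinct outs \<and> set outs = (\<Union>j\<in>{1..i}. occurrences_ending j) \<and>
    real t \<le> E (length T) + 1 + real (p - 1) * (eval_bound + 1) +
      real i * (2 * eval_bound + 1) + real (length outs)"
  using assms
proof (induction i)
  case 0
  have "run 0 = Some (state_at 1 0, [], enc_time T + 1)"
    by (simp add: run_0 state_at_def substr_def)
  moreover have "real (enc_time T) \<le> E (length T)"
    using time_bounds by (simp add: time_bounds_def)
  moreover have "live 1 0" "\<forall>q<1. \<not> live q 0"
    using live_Suc_self[of 0] by (auto simp: live_def)
  ultimately show ?case by (intro exI[of _ 1] exI) auto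
next
  case (Suc i)
  then obtain p outs t where IH: "run i = Some (state_at p i, outs, t)" "live p i" "\<forall>q<p. \<not> live q i"
    "distinct outs" "set outs = (\<Union>j\<in>{1..i}. occurrences_ending j)"
    "real t \<le> E (length T) + 1 + real (p - 1) * (eval_bound + 1) +
      real i * (2 * eval_bound + 1) + real (length outs)"
    by auto
  have p: "1 \<le> p" "p \<le> Suc i" using IH(2) by (auto simp: live_def)
  \<comment> \<open>Dead positions stay dead; this is the minimality that the loop lemma requires at
    its start.\<close>
  have dead: "\<not> live q (Suc i)" if "q < p" for q
    using that IH(3) live_Suc[of q i] p Suc.prems by auto
  obtain q t' where q: "fail_loop f re_time eager D T (Suc i) (state_at p i, t) = Some (state_at q i, t')"
    "p \<le> q" "live q (Suc i)" "live q i \<or> q = Suc (Suc i)" "\<forall>q'<q. \<not> live q' (Suc i)"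
    "real t' \<le> real t + real (q - p) * (eval_bound + 1)"
    using fail_loop_state_at[of p i t] IH(2) Suc.prems dead by blast
  have q1: "1 \<le> q" "q \<le> Suc (Suc i)" using q(3) by (auto simp: live_def)
  define tg where "tg = snd (eval (Suc i) (state_at q i))"
  have tg: "real tg \<le> eval_bound"
    unfolding tg_def using snd_eval_state_at q(4) Suc.prems by blast
  let ?S = "f (substr T q (Suc i))"
  have st: "state_at q (Suc i) = State ?S" using q1 by (simp add: state_at_def)
  have ev: "eval (Suc i) (state_at q i) = (Some (State ?S), tg)"
    using fst_eval_state_at[OF q1 Suc.prems] q(3) st by (simp add: tg_def prod_eq_iff)
  define new where "new = map (\<lambda>k. (k, Suc i - length (D ! k) + 1)) (out_indices eqv f D ?S)"
  have set_new: "set new = occurrences_ending (Suc i)"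
    unfolding new_def using q(3,5) Suc.prems by (intro out_indices_live) auto
  have "distinct new"
    by (simp add: new_def out_indices_def distinct_map inj_on_def)
  moreover have "set outs \<inter> set new = {}"
    unfolding set_new IH(5) by (auto simp: occurrences_ending_def)
  ultimately have "distinct (outs @ new)"
    using IH(4) by simp
  moreover have "run (Suc i) = Some (state_at q (Suc i), outs @ new, t' + 2 * tg + length new + 1)"
    unfolding run_Suc IH(1) st by (simp add: search_step_def q(1) ev new_def Let_def)
  moreover have "set (outs @ new) = (\<Union>j\<in>{1..Suc i}. occurrences_ending j)"
    using set_new IH(5) by (auto simp: atLeastAtMostSuc_conv)
  moreover have "real (t' + 2 * tg + length new + 1) \<le>
      E (length T) + 1 + real (q - 1) * (eval_bound + 1) +
      real (Suc i) * (2 * eval_bound + 1) + real (length (outs @ new))"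
  proof -
    \<comment> \<open>The charges telescope: as \<open>1 \<le> p \<le> q\<close>, the truncated
      subtractions are exact.\<close>
    have "real (q - 1) = real (p - 1) + real (q - p)" using p q(2) by simp
    then show ?thesis using q(6) IH(6) tg by (simp add: algebra_simps)
  qed
  ultimately show ?case
    using q(3,5) by blast
qed

text \<open>An occurrence belongs to its last position \<open>pos + length (D ! k) - 1\<close>,
  which is at least 1 since patterns are nonempty.\<close>

lemma UN_occurrences_ending:
  "(\<Union>j\<in>{1..length T}. occurrences_ending j) = occurrences eqv D T"
proof -
  have "\<exists>j\<in>{1..length T}. (k, pos) \<in> occurrences_ending j" if "(k, pos) \<in> occurrences eqv D T" for k pos
  proof (rule bexI)
    have k: "k < length D" "1 \<le> pos" "int pos \<le> int (length T) - int (length (D ! k)) + 1"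
      using that by (auto simp: occurrences_def occurrence_at_def)
    then have "D ! k \<noteq> []"
      using dictionary by (metis dictionary_def nth_mem)
    then have "1 \<le> length (D ! k)"
      by (simp add: Suc_le_eq)
    then show "pos + length (D ! k) - 1 \<in> {1..length T}"
      and "(k, pos) \<in> occurrences_ending (pos + length (D ! k) - 1)"
      using k that by (auto simp: occurrences_ending_def)
  qed
  then show ?thesis
    by (auto simp: occurrences_ending_def)
qed

section \<open>Total running time\<close>

text \<open>A live position is at most \<open>Suc (length T)\<close>, so the failures cost at most
  \<open>eval_bound + 1\<close> per letter on average; the two further evaluations raise this to
  \<open>3 * eval_bound + 2\<close>. Distinctness turns the output length into the number of
  occurrences.\<close>

lemma search_correct_and_bounded:
  "\<exists>outs time. search eqv f enc_time re_time eager D T = Some (outs, time) \<and>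
     distinct outs \<and> set outs = occurrences eqv D T \<and>
     real time \<le> E (length T) + 1 + real (length T) * (3 * eval_bound + 2) +
       real (card (occurrences eqv D T))"
proof -
  obtain p outs t where run: "run (length T) = Some (state_at p (length T), outs, t)"
    "live p (length T)" "distinct outs" "set outs = occurrences eqv D T"
    "real t \<le> E (length T) + 1 + real (p - 1) * (eval_bound + 1) +
      real (length T) * (2 * eval_bound + 1) + real (length outs)"
    using run_invariant[of "length T"] unfolding UN_occurrences_ending by auto
  have "real (p - 1) * (eval_bound + 1) \<le> real (length T) * (eval_bound + 1)"
    using run(2) eval_bound_nonneg by (intro mult_right_mono) (auto simp: live_def)
  moreover have "length outs = card (occurrences eqv D T)"
    using distinct_card[OF run(3)] run(4) by simp
  ultimately have "real t \<le> E (length T) + 1 + real (length T) * (3 * eval_bound + 2) +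
       real (card (occurrences eqv D T))"
    using run(5) by (simp add: algebra_simps)
  moreover have "search eqv f enc_time re_time eager D T = Some (outs, t)"
    using run(1) by (simp add: search_def run_def)
  ultimately show ?thesis using run by blast
qed

lemma one_le_E: "1 \<le> E (length T)"
proof -
  have "1 \<le> enc_time T" "real (enc_time T) \<le> E (length T)"
    using time_bounds by (auto simp: time_bounds_def)
  then show ?thesis by linarith
qed

text \<open>Three evaluations per letter give \<open>3 * max 1 K\<close>; the 8 is
  \<open>3 * 2 + 2\<close>, the additive constants, absorbed by \<open>1 \<le> R maxlen\<close>. The
  maximum with 1 covers the lazy case, where \<open>R maxlen\<close> itself appears.\<close>

lemma total_time_le:
  assumes "eager \<longrightarrow> R (maxlen + 1) \<le> K * R maxlen" "0 \<le> x"
    and "time \<le> E (length T) + 1 + real (length T) * (3 * eval_bound + 2) + x"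
  shows "time \<le> (3 * max 1 K + 8) *
    (E (length T) + real (length T) * (R maxlen + log 2 (real (max_children f D))) + x)"
proof -
  let ?L = "log 2 (real (max_children f D))" and ?K = "max 1 K"
  have R: "1 \<le> R maxlen" using one_le_max_pattern_length by (rule one_le_R)
  have L: "0 \<le> ?L" by (rule log2_of_nat_nonneg)
  have "K * R maxlen \<le> ?K * R maxlen" "1 * R maxlen \<le> ?K * R maxlen"
    using R by (auto intro!: mult_right_mono)
  then have "R (if eager then maxlen + 1 else maxlen) \<le> ?K * R maxlen"
    using assms(1) by auto
  then have "3 * eval_bound + 2 \<le> 3 * (?K * R maxlen) + 3 * ?L + 8 * R maxlen"
    using R by (simp add: eval_bound_def)
  also have "\<dots> \<le> (3 * ?K + 8) * R maxlen + (3 * ?K + 8) * ?L"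
  proof -
    have "3 * ?L \<le> (3 * ?K + 8) * ?L"
      using L by (intro mult_right_mono) auto
    then show ?thesis by (simp add: algebra_simps)
  qed
  finally have "real (length T) * (3 * eval_bound + 2) \<le>
      real (length T) * ((3 * ?K + 8) * R maxlen + (3 * ?K + 8) * ?L)"
    by (intro mult_left_mono) auto
  moreover have "E (length T) + 1 \<le> (3 * ?K + 8) * E (length T)"
  proof -
    have "2 * E (length T) \<le> (3 * ?K + 8) * E (length T)"
      using one_le_E by (intro mult_right_mono) auto
    then show ?thesis using one_le_E by linarith
  qed
  moreover have "1 * x \<le> (3 * ?K + 8) * x"
    using assms(2) by (intro mult_right_mono) auto
  ultimately show ?thesis
    using assms(3) by (simp only: distrib_left mult.left_commute)
qed

end

text \<open>\<open>C\<close> is chosen before the equivalence, dictionary, text and cost functions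
  and depends on \<open>K\<close> alone, so the bound is uniform. The growth condition for eager
  evaluation guards only the time bound; termination and correctness stand outside it.\<close>

theorem theorem2:
  fixes K :: real
  shows "\<exists>C>0. \<forall>(eqv :: 'a list \<Rightarrow> 'a list \<Rightarrow> bool) (f :: 'a list \<Rightarrow> 'b::linorder list)
      (enc_time :: 'a list \<Rightarrow> nat) (re_time :: 'a list \<Rightarrow> nat \<Rightarrow> nat \<Rightarrow> nat)
      (E :: nat \<Rightarrow> real) (R :: nat \<Rightarrow> real) (D :: 'a list list) (T :: 'a list) (eager :: bool).
    scer eqv \<and> prefix_encoding eqv f \<and> time_bounds enc_time re_time E R \<and> dictionary D \<longrightarrow>
    (\<exists>outs time. search eqv f enc_time re_time eager D T = Some (outs, time) \<and>
       distinct outs \<and> set outs = occurrences eqv D T \<and>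
       ((eager \<longrightarrow> R (max_pattern_length D + 1) \<le> K * R (max_pattern_length D)) \<longrightarrow>
        real time \<le> C * (E (length T)
          + real (length T) * (R (max_pattern_length D) + log 2 (real (max_children f D)))
          + real (card (occurrences eqv D T)))))"
proof (intro exI[of _ "3 * max 1 K + 8"] conjI allI impI)
  show "0 < 3 * max 1 K + 8" by linarith
next
  fix eqv :: "'a list \<Rightarrow> 'a list \<Rightarrow> bool" and f :: "'a list \<Rightarrow> 'b list" and enc_time :: "'a list \<Rightarrow> nat"
    and re_time :: "'a list \<Rightarrow> nat \<Rightarrow> nat \<Rightarrow> nat" and E R :: "nat \<Rightarrow> real"
    and D :: "'a list list" and T :: "'a list" and eager
  assume "scer eqv \<and> prefix_encoding eqv f \<and> time_bounds enc_time re_time E R \<and> dictionary D"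
  then interpret scera_search eqv f enc_time re_time E R D T eager
    by unfold_locales auto
  show "\<exists>outs time. search eqv f enc_time re_time eager D T = Some (outs, time) \<and>
       distinct outs \<and> set outs = occurrences eqv D T \<and>
       ((eager \<longrightarrow> R (max_pattern_length D + 1) \<le> K * R (max_pattern_length D)) \<longrightarrow>
        real time \<le> (3 * max 1 K + 8) * (E (length T)
          + real (length T) * (R (max_pattern_length D) + log 2 (real (max_children f D)))
          + real (card (occurrences eqv D T))))"
    using search_correct_and_bounded total_time_le by (meson of_nat_0_le_iff)
qed

end
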